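(* Let $S$ be a semigroup containing at least two elements. Then $S$ is a subdirectly irreducible semigroup satisfying the identity $ab=ac$ if and only if $S$ is either a two-element left zero semigroup or a two-element zero semigroup.
   Context: A left zero semigroup is a semigroup satisfying the identity $ab=a$. A zero semigroup is a semigroup containing a zero element $0$ such that $ab=0$ for all elements $a,b$. A semigroup $S$ is a subdirect product of semigroups $S_i$ ($i\in I$) if $S$ is isomorphic to a subsemigroup $T$ of the direct product of the $S_i$ such that the restrictions to $T$ of all the projection homomorphisms are surjective. A semigroup $S$ is subdirectly irreducible if, whenever $S$ is written as a subdirect product of a family of semigroups $S_i$ ($i\in I$), for at least one $j\in I$ the projection homomorphism $\pi_j$ maps $S$ onto $S_j$ isomorphically. *)

theory Defs
  imports "HOL-Algebra.Product_Groups"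
begin

text \<open>
  Semigroups are given as \<^typ>\<open>'a monoid\<close> records, so that \<^const>\<open>hom\<close>, \<^const>\<open>iso\<close> and
  \<^const>\<open>product_group\<close> (the direct product of a family), none of which presuppose group
  axioms, can be used. The \<open>one\<close> field is unconstrained and plays no role.
\<close>

locale semigroup_struct =
  fixes G (structure)
  assumes m_closed: "\<lbrakk>x \<in> carrier G; y \<in> carrier G\<rbrakk> \<Longrightarrow> x \<otimes> y \<in> carrier G"
    and m_assoc: "\<lbrakk>x \<in> carrier G; y \<in> carrier G; z \<in> carrier G\<rbrakk>
      \<Longrightarrow> (x \<otimes> y) \<otimes> z = x \<otimes> (y \<otimes> z)"

definition left_zero_semigroup :: "('a, 'm) monoid_scheme \<Rightarrow> bool" where
  "left_zero_semigroup G \<longleftrightarrow> semigroup_struct G \<and>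
     (\<forall>a\<in>carrier G. \<forall>b\<in>carrier G. a \<otimes>\<^bsub>G\<^esub> b = a)"

definition zero_semigroup :: "('a, 'm) monoid_scheme \<Rightarrow> bool" where
  "zero_semigroup G \<longleftrightarrow> semigroup_struct G \<and>
     (\<exists>z\<in>carrier G. (\<forall>a\<in>carrier G. z \<otimes>\<^bsub>G\<^esub> a = z \<and> a \<otimes>\<^bsub>G\<^esub> z = z) \<and>
        (\<forall>a\<in>carrier G. \<forall>b\<in>carrier G. a \<otimes>\<^bsub>G\<^esub> b = z))"

definition subsemigroup :: "'a set \<Rightarrow> ('a, 'm) monoid_scheme \<Rightarrow> bool" where
  "subsemigroup T G \<longleftrightarrow> T \<subseteq> carrier G \<and> (\<forall>x\<in>T. \<forall>y\<in>T. x \<otimes>\<^bsub>G\<^esub> y \<in> T)"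

text \<open>
  \<open>T\<close> witnesses that \<open>S\<close> is a subdirect product of the semigroups \<open>F i\<close>, \<open>i \<in> I\<close>.
\<close>

definition subdirect_product_via ::
  "('a, 'm) monoid_scheme \<Rightarrow> 'i set \<Rightarrow> ('i \<Rightarrow> 'b monoid) \<Rightarrow> ('i \<Rightarrow> 'b) set \<Rightarrow> bool" where
  "subdirect_product_via S I F T \<longleftrightarrow>
     (\<forall>i\<in>I. semigroup_struct (F i)) \<and>
     subsemigroup T (product_group I F) \<and>
     S \<cong> (product_group I F)\<lparr>carrier := T\<rparr> \<and>
     (\<forall>i\<in>I. (\<lambda>t. t i) ` T = carrier (F i))"

text \<open>
  HOL cannot quantify over types inside a formula, so the types of indices and of factor elements
  are made explicit first.
\<close>

definition subdirectly_irreducible_wrt ::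
  "'i itself \<Rightarrow> 'b itself \<Rightarrow> ('a, 'm) monoid_scheme \<Rightarrow> bool" where
  "subdirectly_irreducible_wrt _ _ S \<longleftrightarrow> semigroup_struct S \<and>
     (\<forall>(I :: 'i set) (F :: 'i \<Rightarrow> 'b monoid) T. subdirect_product_via S I F T \<longrightarrow>
        (\<exists>j\<in>I. (\<lambda>t. t j) \<in> iso ((product_group I F)\<lparr>carrier := T\<rparr>) (F j)))"

text \<open>
  Every factor of a subdirect product is isomorphic to the quotient of \<open>S\<close> by the kernel
  congruence of the corresponding projection. Hence it suffices to take factors whose elements are
  sets of elements of \<open>S\<close>, indexed by binary relations on \<open>S\<close>; the lemma
  \<open>subdirectly_irreducible_all_types\<close> below shows that the property then holds
  for families over arbitrary types.
\<close>

definition subdirectly_irreducible :: "('a, 'm) monoid_scheme \<Rightarrow> bool" where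
  "subdirectly_irreducible S \<longleftrightarrow>
     subdirectly_irreducible_wrt TYPE(('a \<times> 'a) set) TYPE('a set) S"

lemma subdirectly_irreducible_all_types:
  fixes S :: "('a, 'm) monoid_scheme"
  assumes "subdirectly_irreducible S"
  shows "subdirectly_irreducible_wrt TYPE('i) TYPE('b) S"
proof -
  have SI: "semigroup_struct S"
    and irr: "\<And>(I :: ('a \<times> 'a) set set) (F :: ('a \<times> 'a) set \<Rightarrow> 'a set monoid) T.
      subdirect_product_via S I F T \<Longrightarrow>
        \<exists>j\<in>I. (\<lambda>t. t j) \<in> iso ((product_group I F)\<lparr>carrier := T\<rparr>) (F j)"
    using assms unfolding subdirectly_irreducible_def subdirectly_irreducible_wrt_def by auto
  have "\<exists>j\<in>I. (\<lambda>t. t j) \<in> iso ((product_group I F)\<lparr>carrier := T\<rparr>) (F j)"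
    if sub: "subdirect_product_via S I F T"
    for I :: "'i set" and F :: "'i \<Rightarrow> 'b monoid" and T
  proof -
    let ?C = "carrier S"
    from sub have semiF: "\<And>i. i \<in> I \<Longrightarrow> semigroup_struct (F i)"
      and TP: "T \<subseteq> (\<Pi>\<^sub>E i\<in>I. carrier (F i))"
      and surj: "\<And>i. i \<in> I \<Longrightarrow> (\<lambda>t. t i) ` T = carrier (F i)"
      and "S \<cong> (product_group I F)\<lparr>carrier := T\<rparr>"
      unfolding subdirect_product_via_def subsemigroup_def by auto
    then obtain h where h: "h \<in> iso S ((product_group I F)\<lparr>carrier := T\<rparr>)"
      unfolding is_iso_def by auto
    have bij: "bij_betw h ?C T" using h unfolding iso_def by auto
    have hT: "h x \<in> T" if "x \<in> ?C" for x using bij that by (auto simp: bij_betw_def)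
    have hm: "h (x \<otimes>\<^bsub>S\<^esub> y) i = h x i \<otimes>\<^bsub>F i\<^esub> h y i"
      if "x \<in> ?C" "y \<in> ?C" "i \<in> I" for x y i
      using h that unfolding iso_def hom_def by (auto simp: mult_product_group)
    define ker where "ker i = {(x, y). x \<in> ?C \<and> y \<in> ?C \<and> h x i = h y i}" for i
    define cl where "cl \<theta> x = \<theta> `` {x}" for \<theta> :: "('a \<times> 'a) set" and x
    define J where "J = ker ` I"
    define rp where "rp A = (SOME x. x \<in> A)" for A :: "'a set"
    define Q where "Q \<theta> = \<lparr>carrier = cl \<theta> ` ?C,
        mult = (\<lambda>A B. cl \<theta> (rp A \<otimes>\<^bsub>S\<^esub> rp B)), one = {}\<rparr>" for \<theta>
    define g where "g x = (\<lambda>\<theta>\<in>J. cl \<theta> x)" for x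
    have cl_eq: "cl (ker i) x = cl (ker i) y \<longleftrightarrow> h x i = h y i"
      if "x \<in> ?C" "y \<in> ?C" for x y i
      using that unfolding cl_def ker_def by auto
    have rp: "rp (cl (ker i) x) \<in> ?C \<and> h (rp (cl (ker i) x)) i = h x i" if "x \<in> ?C" for x i
    proof -
      have "x \<in> cl (ker i) x" using that unfolding cl_def ker_def by auto
      then have "rp (cl (ker i) x) \<in> cl (ker i) x" unfolding rp_def by (rule someI)
      then show ?thesis unfolding cl_def ker_def by auto
    qed
    have mC: "x \<otimes>\<^bsub>S\<^esub> y \<in> ?C" if "x \<in> ?C" "y \<in> ?C" for x y
      using SI that unfolding semigroup_struct_def by auto
    have assoc: "(x \<otimes>\<^bsub>S\<^esub> y) \<otimes>\<^bsub>S\<^esub> z = x \<otimes>\<^bsub>S\<^esub> (y \<otimes>\<^bsub>S\<^esub> z)"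
      if "x \<in> ?C" "y \<in> ?C" "z \<in> ?C" for x y z
      using SI that unfolding semigroup_struct_def by auto
    have Qm: "cl \<theta> x \<otimes>\<^bsub>Q \<theta>\<^esub> cl \<theta> y = cl \<theta> (x \<otimes>\<^bsub>S\<^esub> y)"
      if "\<theta> \<in> J" "x \<in> ?C" "y \<in> ?C" for \<theta> x y
    proof -
      from that obtain i where i: "i \<in> I" "\<theta> = ker i" unfolding J_def by auto
      show ?thesis using that i rp[of x i] rp[of y i]
        by (simp add: Q_def cl_eq mC hm)
    qed
    have Qc: "carrier (Q \<theta>) = cl \<theta> ` ?C" for \<theta> unfolding Q_def by simp
    have semiQ: "semigroup_struct (Q \<theta>)" if "\<theta> \<in> J" for \<theta>
      using that by (auto simp: semigroup_struct_def Qc Qm mC assoc)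
    have gm: "g x \<otimes>\<^bsub>product_group J Q\<^esub> g y = g (x \<otimes>\<^bsub>S\<^esub> y)" if "x \<in> ?C" "y \<in> ?C" for x y
      using that by (auto simp: g_def mult_product_group Qm intro!: restrict_ext)
    have ginj: "inj_on g ?C"
    proof (rule inj_onI)
      fix x y assume xy: "x \<in> ?C" "y \<in> ?C" "g x = g y"
      have "h x i = h y i" if "i \<in> I" for i
      proof -
        have "ker i \<in> J" using that unfolding J_def by auto
        then have "cl (ker i) x = cl (ker i) y"
          using fun_cong[OF xy(3), of "ker i"] unfolding g_def by simp
        then show ?thesis using cl_eq xy by blast
      qed
      moreover have "h x \<in> (\<Pi>\<^sub>E i\<in>I. carrier (F i))" "h y \<in> (\<Pi>\<^sub>E i\<in>I. carrier (F i))"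
        using hT xy TP by auto
      ultimately have "h x = h y" by (meson PiE_ext)
      then show "x = y" using bij xy by (auto simp: bij_betw_def inj_on_def)
    qed
    have "g \<in> iso S ((product_group J Q)\<lparr>carrier := g ` ?C\<rparr>)"
      unfolding iso_def hom_def bij_betw_def using ginj gm by simp
    then have "S \<cong> (product_group J Q)\<lparr>carrier := g ` ?C\<rparr>"
      unfolding is_iso_def by auto
    moreover have "subsemigroup (g ` ?C) (product_group J Q)"
      unfolding subsemigroup_def using gm mC by (auto simp: g_def Qc)
    moreover have "\<forall>\<theta>\<in>J. (\<lambda>t. t \<theta>) ` (g ` ?C) = carrier (Q \<theta>)"
      by (auto simp: g_def Qc image_image)
    ultimately have "subdirect_product_via S J Q (g ` ?C)"
      unfolding subdirect_product_via_def using semiQ by blast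
    from irr[OF this] obtain \<theta> where \<theta>: "\<theta> \<in> J"
      "(\<lambda>t. t \<theta>) \<in> iso ((product_group J Q)\<lparr>carrier := g ` ?C\<rparr>) (Q \<theta>)" by blast
    then obtain j where j: "j \<in> I" "\<theta> = ker j" unfolding J_def by auto
    have inj\<theta>: "inj_on (\<lambda>t. t \<theta>) (g ` ?C)" using \<theta>(2) unfolding iso_def bij_betw_def by auto
    have "inj_on (\<lambda>t. t j) T"
    proof (rule inj_onI)
      fix s t assume st: "s \<in> T" "t \<in> T" "s j = t j"
      then obtain x y where xy: "x \<in> ?C" "y \<in> ?C" "s = h x" "t = h y"
        using bij by (auto simp: bij_betw_def)
      have "cl \<theta> x = cl \<theta> y" using cl_eq st xy j by blast
      then have "g x \<theta> = g y \<theta>" using \<theta>(1) unfolding g_def by simp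
      then have "g x = g y" using inj\<theta> xy by (auto simp: inj_on_def)
      then show "s = t" using ginj xy by (auto simp: inj_on_def)
    qed
    then have "(\<lambda>t. t j) \<in> iso ((product_group I F)\<lparr>carrier := T\<rparr>) (F j)"
      unfolding iso_def hom_def bij_betw_def
      using surj[OF j(1)] j(1) by (auto simp: mult_product_group)
    then show ?thesis using j by blast
  qed
  then show ?thesis using SI unfolding subdirectly_irreducible_wrt_def by blast
qed

end

theory Submission
  imports Defs
begin

text \<open>
  The identity \<open>ab = ac\<close> says that \<open>ab = f a\<close> for a map \<open>f\<close>, which associativity forces to be
  idempotent; endomorphisms are exactly the maps commuting with \<open>f\<close>. In a subdirectly irreducible
  semigroup, two endomorphisms that jointly separate points cannot both fail to be injective.
  If \<open>f\<close> moves some \<open>x\<close> and fixes a point \<open>p \<noteq> f x\<close>, such a pair is obtained by sending \<open>x\<close>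
  to \<open>f x\<close> and by sending the whole fibre \<open>f -` {p}\<close> to \<open>f x\<close>. Hence \<open>f\<close> is the identity or
  constant; in both cases, if there are three elements, then for a suitable \<open>z\<close> the two maps
  sending one other element to \<open>z\<close> form such a pair.
\<close>

lemma semigroup_struct_hom_image:
  assumes "semigroup_struct S" and "semigroup_struct H" and "g \<in> hom S H"
  shows "semigroup_struct (H\<lparr>carrier := g ` carrier S\<rparr>)"
proof
  fix x y assume "x \<in> carrier (H\<lparr>carrier := g ` carrier S\<rparr>)" "y \<in> carrier (H\<lparr>carrier := g ` carrier S\<rparr>)"
  then obtain a b where ab: "a \<in> carrier S" "b \<in> carrier S" "x = g a" "y = g b" by auto
  then have "x \<otimes>\<^bsub>H\<^esub> y = g (a \<otimes>\<^bsub>S\<^esub> b)" using assms(3) by (simp add: hom_def)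
  then show "x \<otimes>\<^bsub>H\<lparr>carrier := g ` carrier S\<rparr>\<^esub> y \<in> carrier (H\<lparr>carrier := g ` carrier S\<rparr>)"
    using ab semigroup_struct.m_closed[OF assms(1)] by auto
next
  fix x y z
  assume "x \<in> carrier (H\<lparr>carrier := g ` carrier S\<rparr>)" "y \<in> carrier (H\<lparr>carrier := g ` carrier S\<rparr>)"
    "z \<in> carrier (H\<lparr>carrier := g ` carrier S\<rparr>)"
  moreover have "g ` carrier S \<subseteq> carrier H" using assms(3) by (auto simp: hom_def)
  ultimately have "x \<in> carrier H" "y \<in> carrier H" "z \<in> carrier H" by auto
  then show "(x \<otimes>\<^bsub>H\<lparr>carrier := g ` carrier S\<rparr>\<^esub> y) \<otimes>\<^bsub>H\<lparr>carrier := g ` carrier S\<rparr>\<^esub> z =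
      x \<otimes>\<^bsub>H\<lparr>carrier := g ` carrier S\<rparr>\<^esub> (y \<otimes>\<^bsub>H\<lparr>carrier := g ` carrier S\<rparr>\<^esub> z)"
    by (simp add: semigroup_struct.m_assoc[OF assms(2)])
qed

text \<open>Separation makes the tupling of the \<open>g i\<close> an embedding of \<open>S\<close>
  into the product, so \<open>S\<close> is a subdirect product of the images. The projection that
  irreducibility provides, composed with this embedding, is one of the \<open>g j\<close>.\<close>

lemma subdirectly_irreducible_separating_homs:
  fixes S :: "('a, 'm) monoid_scheme" and F :: "'i \<Rightarrow> 'b monoid"
  assumes irr: "subdirectly_irreducible S"
    and F: "\<And>i. i \<in> I \<Longrightarrow> semigroup_struct (F i)"
    and g: "\<And>i. i \<in> I \<Longrightarrow> g i \<in> hom S (F i)"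
    and sep: "\<And>x y. \<lbrakk>x \<in> carrier S; y \<in> carrier S; \<And>i. i \<in> I \<Longrightarrow> g i x = g i y\<rbrakk> \<Longrightarrow> x = y"
  shows "\<exists>j\<in>I. inj_on (g j) (carrier S)"
proof -
  let ?C = "carrier S"
  \<comment> \<open>Each factor is cut down to the image of \<open>g i\<close>, because a subdirect
    product needs surjective projections.\<close>
  define Q where "Q i = (F i)\<lparr>carrier := g i ` ?C\<rparr>" for i
  define h where "h x = (\<lambda>i\<in>I. g i x)" for x
  have wrt: "subdirectly_irreducible_wrt TYPE('i) TYPE('b) S"
    by (rule subdirectly_irreducible_all_types[OF irr])
  then have S: "semigroup_struct S" by (simp add: subdirectly_irreducible_wrt_def)
  have hm: "h x \<otimes>\<^bsub>product_group I Q\<^esub> h y = h (x \<otimes>\<^bsub>S\<^esub> y)" if "x \<in> ?C" "y \<in> ?C" for x y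
    using that g by (auto simp: h_def Q_def mult_product_group hom_def intro!: restrict_ext)
  have hinj: "inj_on h ?C"
  proof (rule inj_onI)
    fix x y assume xy: "x \<in> ?C" "y \<in> ?C" "h x = h y"
    show "x = y"
    proof (rule sep[OF xy(1,2)])
      fix i assume "i \<in> I"
      then show "g i x = g i y" using fun_cong[OF xy(3), of i] by (simp add: h_def)
    qed
  qed
  have "h \<in> iso S ((product_group I Q)\<lparr>carrier := h ` ?C\<rparr>)"
    unfolding iso_def hom_def bij_betw_def using hinj hm by simp
  then have "S \<cong> (product_group I Q)\<lparr>carrier := h ` ?C\<rparr>"
    unfolding is_iso_def by auto
  moreover have "subsemigroup (h ` ?C) (product_group I Q)"
    unfolding subsemigroup_def using hm semigroup_struct.m_closed[OF S]
    by (auto simp: h_def Q_def)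
  moreover have "\<forall>i\<in>I. (\<lambda>t. t i) ` (h ` ?C) = carrier (Q i)"
    by (auto simp: h_def Q_def image_image)
  moreover have "\<forall>i\<in>I. semigroup_struct (Q i)"
    unfolding Q_def using semigroup_struct_hom_image[OF S F g] by blast
  ultimately have "subdirect_product_via S I Q (h ` ?C)"
    unfolding subdirect_product_via_def by blast
  then obtain j where j: "j \<in> I"
    and "(\<lambda>t. t j) \<in> iso ((product_group I Q)\<lparr>carrier := h ` ?C\<rparr>) (Q j)"
    using wrt unfolding subdirectly_irreducible_wrt_def by blast
  then have "inj_on (\<lambda>t. t j) (h ` ?C)" by (simp add: iso_def bij_betw_def)
  then have "inj_on ((\<lambda>t. t j) \<circ> h) ?C" using hinj by (rule comp_inj_on[rotated])
  then have "inj_on (g j) ?C" using j by (simp add: h_def inj_on_def)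
  then show ?thesis using j by blast
qed

text \<open>This is a family indexed by \<open>bool\<close> with every factor equal to
  \<open>S\<close>.\<close>

lemma subdirectly_irreducible_endomorphisms:
  fixes S :: "'a monoid"
  assumes irr: "subdirectly_irreducible S"
    and g: "g1 \<in> hom S S" "g2 \<in> hom S S"
    and sep: "\<And>x y. \<lbrakk>x \<in> carrier S; y \<in> carrier S; g1 x = g1 y; g2 x = g2 y\<rbrakk> \<Longrightarrow> x = y"
  shows "inj_on g1 (carrier S) \<or> inj_on g2 (carrier S)"
proof -
  have S: "semigroup_struct S"
    using irr by (simp add: subdirectly_irreducible_def subdirectly_irreducible_wrt_def)
  have "\<exists>j\<in>UNIV. inj_on (if j then g1 else g2) (carrier S)"
  proof (rule subdirectly_irreducible_separating_homs[OF irr, where F = "\<lambda>_. S"])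
    fix x y
    assume xy: "x \<in> carrier S" "y \<in> carrier S"
      and eq: "\<And>i. i \<in> UNIV \<Longrightarrow> (if i then g1 else g2) x = (if i then g1 else g2) y"
    show "x = y" using sep[OF xy] eq[of True] eq[of False] by simp
  qed (use S g in auto)
  then show ?thesis by (auto split: if_splits)
qed

lemma subdirectly_irreducible_two_elements:
  fixes S :: "('a, 'm) monoid_scheme"
  assumes S: "semigroup_struct S" and card: "card (carrier S) = 2"
  shows "subdirectly_irreducible S"
  unfolding subdirectly_irreducible_def subdirectly_irreducible_wrt_def
proof (intro conjI allI impI)
  fix I :: "('a \<times> 'a) set set" and F :: "('a \<times> 'a) set \<Rightarrow> 'a set monoid" and T
  assume "subdirect_product_via S I F T"
  then have TP: "T \<subseteq> (\<Pi>\<^sub>E i\<in>I. carrier (F i))"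
    and surj: "\<And>i. i \<in> I \<Longrightarrow> (\<lambda>t. t i) ` T = carrier (F i)"
    and "S \<cong> (product_group I F)\<lparr>carrier := T\<rparr>"
    unfolding subdirect_product_via_def subsemigroup_def by auto
  then obtain h where "bij_betw h (carrier S) T"
    unfolding is_iso_def iso_def by auto
  then have "card T = 2" using card bij_betw_same_card by fastforce
  then obtain s t where T: "T = {s, t}" and "s \<noteq> t" by (auto simp: card_2_iff)
  \<comment> \<open>Elements of \<open>T\<close> are extensional, so two distinct ones differ at an
    index in \<open>I\<close>; projecting there is injective on the pair.\<close>
  then obtain j where j: "j \<in> I" "s j \<noteq> t j"
    using TP PiE_ext by (metis insert_subset)
  have "(\<lambda>t. t j) \<in> iso ((product_group I F)\<lparr>carrier := T\<rparr>) (F j)"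
    unfolding iso_def hom_def bij_betw_def
    using surj[OF j(1)] j T by (auto simp: mult_product_group)
  then show "\<exists>j\<in>I. (\<lambda>t. t j) \<in> iso ((product_group I F)\<lparr>carrier := T\<rparr>) (F j)"
    using j(1) by blast
qed (rule S)

theorem theorem7:
  fixes S :: "'a monoid"
  assumes "semigroup_struct S"
    and "\<exists>x\<in>carrier S. \<exists>y\<in>carrier S. x \<noteq> y"
  shows "(subdirectly_irreducible S \<and>
           (\<forall>a\<in>carrier S. \<forall>b\<in>carrier S. \<forall>c\<in>carrier S. a \<otimes>\<^bsub>S\<^esub> b = a \<otimes>\<^bsub>S\<^esub> c))
     \<longleftrightarrow> ((left_zero_semigroup S \<and> card (carrier S) = 2) \<or>
          (zero_semigroup S \<and> card (carrier S) = 2))"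
    (is "?L \<longleftrightarrow> ?R")
proof
  assume ?R
  then have "card (carrier S) = 2" by blast
  then have "subdirectly_irreducible S"
    by (rule subdirectly_irreducible_two_elements[OF assms(1)])
  moreover have "a \<otimes>\<^bsub>S\<^esub> b = a \<otimes>\<^bsub>S\<^esub> c" if "a \<in> carrier S" "b \<in> carrier S" "c \<in> carrier S" for a b c
    using \<open>?R\<close> that by (auto simp: left_zero_semigroup_def zero_semigroup_def)
  ultimately show ?L by blast
next
  assume ?L
  then have irr: "subdirectly_irreducible S"
    and ident: "\<And>a b c. \<lbrakk>a \<in> carrier S; b \<in> carrier S; c \<in> carrier S\<rbrakk>
      \<Longrightarrow> a \<otimes>\<^bsub>S\<^esub> b = a \<otimes>\<^bsub>S\<^esub> c"
    by blast+
  let ?C = "carrier S"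
  define f where "f a = a \<otimes>\<^bsub>S\<^esub> a" for a
  have mult: "a \<otimes>\<^bsub>S\<^esub> b = f a" if "a \<in> ?C" "b \<in> ?C" for a b
    using ident that unfolding f_def by blast
  have fC: "f a \<in> ?C" if "a \<in> ?C" for a
    unfolding f_def using semigroup_struct.m_closed[OF assms(1)] that by blast
  \<comment> \<open>Here \<open>(aa)a\<close> is \<open>f (f a)\<close>, whereas
    \<open>a(aa)\<close> is \<open>f a\<close>.\<close>
  have ff: "f (f a) = f a" if "a \<in> ?C" for a
    using semigroup_struct.m_assoc[OF assms(1) that that that] that by (simp add: mult fC)
  have endo: "g \<in> hom S S"
    if "\<And>x. x \<in> ?C \<Longrightarrow> g x \<in> ?C" "\<And>x. x \<in> ?C \<Longrightarrow> g (f x) = f (g x)" for g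
    using that by (auto simp: hom_def mult)
  have const: "f y = f x" if x: "x \<in> ?C" "f x \<noteq> x" and y: "y \<in> ?C" for x y
  proof (rule ccontr)
    assume neq: "f y \<noteq> f x"
    define g1 where "g1 = id(x := f x)"
    define g2 where "g2 z = (if f z = f y then f x else z)" for z
    have "g1 \<in> hom S S" using x by (intro endo) (auto simp: g1_def fC ff)
    moreover have "g2 \<in> hom S S" using x y by (intro endo) (auto simp: g2_def fC ff)
    \<comment> \<open>Only \<open>x\<close> and \<open>f x\<close> are merged by \<open>g1\<close>.
      Neither lies in the fibre of \<open>f\<close> over \<open>f y\<close>, since
      \<open>f (f x) = f x\<close>, so \<open>g2\<close> fixes both and keeps them apart.\<close>
    moreover have "u = v" if "u \<in> ?C" "v \<in> ?C" "g1 u = g1 v" "g2 u = g2 v" for u v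
      using that x neq by (auto simp: g1_def g2_def ff split: if_splits)
    ultimately have "inj_on g1 ?C \<or> inj_on g2 ?C"
      by (rule subdirectly_irreducible_endomorphisms[OF irr])
    moreover have "g1 x = g1 (f x)" using x by (simp add: g1_def)
    \<comment> \<open>The point \<open>f y\<close> lies in its own fibre by idempotence, so
      \<open>g2\<close> sends it to \<open>f x\<close>, which \<open>g2\<close> fixes.\<close>
    moreover have "g2 (f y) = g2 (f x)" using x y by (simp add: g2_def ff)
    ultimately show False using x y neq fC unfolding inj_on_def by metis
  qed
  \<comment> \<open>The hypothesis \<open>fz\<close> makes each map sending a single
    \<open>a\<close> to \<open>z\<close> an endomorphism. For distinct \<open>a\<close> and
    \<open>b\<close> other than \<open>z\<close>, the first map merges only \<open>a\<close> with
    \<open>z\<close>, and the second fixes \<open>a\<close> but moves \<open>b\<close>; so they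
    separate points though neither is injective. Hence only one element besides \<open>z\<close>
    exists.\<close>
  have card2: "card ?C = 2"
    if z: "z \<in> ?C" and fz: "\<And>a x. \<lbrakk>a \<in> ?C - {z}; x \<in> ?C\<rbrakk> \<Longrightarrow> (id(a := z)) (f x) = f ((id(a := z)) x)" for z
  proof -
    have eq: "a = b" if ab: "a \<in> ?C - {z}" "b \<in> ?C - {z}" for a b
    proof (rule ccontr)
      assume neq: "a \<noteq> b"
      have "id(a := z) \<in> hom S S" if "a \<in> ?C - {z}" for a
        using that z fz by (intro endo) auto
      then have "inj_on (id(a := z)) ?C \<or> inj_on (id(b := z)) ?C"
        using ab neq
        by (intro subdirectly_irreducible_endomorphisms[OF irr]) (auto split: if_splits)
      moreover have "\<not> inj_on (id(a := z)) ?C" if "a \<in> ?C - {z}" for a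
        using inj_onD[of "id(a := z)" ?C a z] that z by auto
      ultimately show False using ab by blast
    qed
    obtain w where "w \<in> ?C" "w \<noteq> z" using assms(2) by metis
    with eq z have "?C = {z, w}" by auto
    then show ?thesis using \<open>w \<noteq> z\<close> by simp
  qed
  show ?R
  proof (cases "\<forall>x\<in>?C. f x = x")
    case True
    \<comment> \<open>Every self-map commutes with the identity, so any \<open>z\<close>
      serves.\<close>
    obtain z where "z \<in> ?C" using assms(2) by blast
    then have "card ?C = 2" using True by (intro card2) auto
    moreover have "left_zero_semigroup S"
      using assms(1) True by (simp add: left_zero_semigroup_def mult)
    ultimately show ?thesis by blast
  next
    case False
    then obtain x where x: "x \<in> ?C" "f x \<noteq> x" by blast
    define c where "c = f x"
    have c: "c \<in> ?C" using x fC by (simp add: c_def)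
    have fc: "f y = c" if "y \<in> ?C" for y unfolding c_def using const x that by blast
    \<comment> \<open>The choice \<open>z = c\<close> is forced by commutation with the constant
      map: an endomorphism must fix \<open>c\<close>, and \<open>a\<close> then ranges over the
      other elements only.\<close>
    have "card ?C = 2" using c by (rule card2) (auto simp: fc c)
    moreover have "zero_semigroup S"
      unfolding zero_semigroup_def using assms(1) c
      by (intro conjI bexI[of _ c]) (simp_all add: mult fc)
    ultimately show ?thesis by blast
  qed
qed

end
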